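(* Let $n,k,m$ be positive integers with $k\le m$. Then $\mu(n,k,m;k)=\frac{kn}{m}$ if and only if $n=c\cdot\frac{m}{\gcd{(m,k)}}$ for some integer $c\geq 0$.
   Context: An $(n,N,k,m;r)$ multiset combinatorial batch code (MCBC) is a collection $\mathcal C=\{C_1,\dots,C_m\}$ of subsets of $[n]=\{1,\dots,n\}$ (servers) with $N=\sum_{j=1}^m|C_j|$, such that for every multiset request $\{i_1,\dots,i_k\}$ of $k$ elements of $[n]$ in which every element has multiplicity at most $r$, there exist subsets $D_j\subseteq C_j$ with $|D_j|\le 1$ ($j\in[m]$) whose multiset union (the multiplicity of $i$ being $|\{j: i\in D_j\}|$) contains the request. An MCBC is regular if every server stores the same number $\mu=N/m$ of items, i.e. $|C_1|=\dots=|C_m|$. $\mu(n,k,m;r)$ denotes the smallest $\mu$ for which a regular $(n,m\mu,k,m;r)$-MCBC exists. *)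

theory Defs
  imports Complex_Main "HOL-Library.Multiset"
begin

text \<open>
  Servers are a family indexed by \<open>{1..m}\<close> rather than a set of sets: distinct servers
  may store the same items, and each of them counts in \<open>N\<close>.
\<close>

definition mcbc :: "nat \<Rightarrow> nat \<Rightarrow> nat \<Rightarrow> nat \<Rightarrow> nat \<Rightarrow> (nat \<Rightarrow> nat set) \<Rightarrow> bool" where
  "mcbc n N k m r C \<longleftrightarrow>
     (\<forall>j\<in>{1..m}. C j \<subseteq> {1..n}) \<and>
     N = (\<Sum>j=1..m. card (C j)) \<and>
     (\<forall>R :: nat multiset.
        set_mset R \<subseteq> {1..n} \<and> size R = k \<and> (\<forall>i. count R i \<le> r) \<longrightarrow>
        (\<exists>D :: nat \<Rightarrow> nat set.
           (\<forall>j\<in>{1..m}. D j \<subseteq> C j \<and> card (D j) \<le> 1) \<and>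
           R \<subseteq># (\<Sum>j=1..m. mset_set (D j))))"

definition regular_mcbc :: "nat \<Rightarrow> nat \<Rightarrow> nat \<Rightarrow> nat \<Rightarrow> nat \<Rightarrow> (nat \<Rightarrow> nat set) \<Rightarrow> bool" where
  "regular_mcbc n N k m r C \<longleftrightarrow>
     mcbc n N k m r C \<and> (\<forall>i\<in>{1..m}. \<forall>j\<in>{1..m}. card (C i) = card (C j))"

text \<open>
  For \<open>k \<le> m\<close> the minimum exists: storing all \<open>n\<close> items on every server gives a regular
  code with \<open>\<mu> = n\<close>. For \<open>k > m\<close> there may be no code, and then \<open>LEAST\<close> is unspecified.
\<close>

definition min_storage :: "nat \<Rightarrow> nat \<Rightarrow> nat \<Rightarrow> nat \<Rightarrow> nat" where
  "min_storage n k m r = (LEAST \<mu>. \<exists>C. regular_mcbc n (m * \<mu>) k m r C)"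

end

theory Submission
  imports Defs
begin

text \<open>
  Taking \<open>r = k\<close> allows the request of \<open>k\<close> copies of one item, so every item must lie on at
  least \<open>k\<close> servers; conversely, that suffices to serve any request greedily. Hence
  \<open>m \<mu> \<ge> k n\<close>, and equality forces \<open>m\<close> to divide \<open>k n\<close>. If \<open>m\<close> divides \<open>k n\<close>, dealing
  \<open>k\<close> copies of each item in turn to the servers in cyclic order attains equality.
\<close>

section \<open>Replication of items and greedy service of requests\<close>

definition servers :: "nat \<Rightarrow> (nat \<Rightarrow> nat set) \<Rightarrow> nat \<Rightarrow> nat set" where
  "servers m C i = {j\<in>{1..m}. i \<in> C j}"

lemma finite_servers [simp]: "finite (servers m C i)"
  by (simp add: servers_def)

text \<open>Double counting of the pairs \<open>(i, j)\<close> with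
  \<open>i \<in> C j\<close>.\<close>

lemma sum_card_eq_sum_servers:
  assumes "\<forall>j\<in>{1..m}. C j \<subseteq> {1..n}"
  shows "(\<Sum>j=1..m. card (C j)) = (\<Sum>i=1..n. card (servers m C i))"
proof -
  have "(\<Sum>j=1..m. card (C j)) = (\<Sum>j=1..m. card {i\<in>{1..n}. i \<in> C j})"
    using assms by (intro sum.cong refl arg_cong[where f = card]) blast
  also have "\<dots> = (\<Sum>i=1..n. card {j\<in>{1..m}. i \<in> C j})"
    by (intro sum_multicount_gen) auto
  finally show ?thesis
    by (simp add: servers_def)
qed

text \<open>\<open>J\<close> is the set of servers already in use and \<open>f j\<close> the item
  read from server \<open>j\<close>. Fewer than \<open>k\<close> servers are busy when the next item
  is to be served, so one of its \<open>k\<close> servers is still free. Only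
  \<open>size R \<le> k\<close> is demanded, so that the induction can pass through partial
  requests.\<close>

lemma greedy_assignment:
  assumes "set_mset R \<subseteq> {1..n}" and "size R \<le> k"
    and "\<forall>i\<in>{1..n}. k \<le> card (servers m C i)"
  shows "\<exists>J f. J \<subseteq> {1..m} \<and> card J = size R \<and> (\<forall>j\<in>J. f j \<in> C j) \<and>
           R = image_mset f (mset_set J)"
  using assms(1,2)
proof (induction R)
  case empty
  then show ?case by (intro exI[of _ "{}"]) auto
next
  case (add i R)
  have "set_mset R \<subseteq> {1..n}" and "size R \<le> k"
    using add.prems by auto
  from add.IH[OF this] obtain J f where J: "J \<subseteq> {1..m}" "card J = size R"
      "\<forall>j\<in>J. f j \<in> C j" "R = image_mset f (mset_set J)"
    by blast
  have fin: "finite J"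
    using J(1) finite_subset by blast
  have "card J < k"
    using add.prems(2) J(2) by simp
  also have "k \<le> card (servers m C i)"
    using add.prems(1) assms(3) by simp
  finally have "\<not> servers m C i \<subseteq> J"
    using card_mono[OF fin] by (meson not_le)
  then obtain j where j: "j \<in> {1..m}" "i \<in> C j" "j \<notin> J"
    by (auto simp: servers_def)
  have "image_mset (f(j := i)) (mset_set J) = R"
    using j(3) fin unfolding J(4) by (intro image_mset_cong) auto
  then have "add_mset i R = image_mset (f(j := i)) (mset_set (insert j J))"
    using j(3) fin by (simp del: fun_upd_apply) (simp only: fun_upd_same)
  moreover have "\<forall>x\<in>insert j J. (f(j := i)) x \<in> C x" and "insert j J \<subseteq> {1..m}"
      and "card (insert j J) = size (add_mset i R)"
    using J(1,2,3) j fin by auto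
  ultimately show ?case
    by blast
qed

lemma mcbc_if_servers:
  assumes "\<forall>j\<in>{1..m}. C j \<subseteq> {1..n}" and "N = (\<Sum>j=1..m. card (C j))"
    and "\<forall>i\<in>{1..n}. k \<le> card (servers m C i)"
  shows "mcbc n N k m r C"
  unfolding mcbc_def
proof (intro conjI allI impI)
  fix R :: "nat multiset"
  assume R: "set_mset R \<subseteq> {1..n} \<and> size R = k \<and> (\<forall>i. count R i \<le> r)"
  then have "set_mset R \<subseteq> {1..n}" and "size R \<le> k"
    by auto
  from greedy_assignment[OF this assms(3)] obtain J f
    where J: "J \<subseteq> {1..m}" "\<forall>j\<in>J. f j \<in> C j" "R = image_mset f (mset_set J)"
    by blast
  \<comment> \<open>Idle servers contribute the empty set, so the sum over all servers reduces to
    the sum over \<open>J\<close>.\<close>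
  define D where "D j = (if j \<in> J then {f j} else {})" for j
  have "(\<Sum>j=1..m. mset_set (D j)) = (\<Sum>j\<in>J. mset_set (D j))"
    using J(1) by (intro sum.mono_neutral_right) (auto simp: D_def)
  also have "\<dots> = (\<Sum>j\<in>J. {#f j#})"
    by (simp add: D_def)
  also have "\<dots> = R"
    using J(3) by (simp add: sum_unfold_sum_mset)
  finally have "R \<subseteq># (\<Sum>j=1..m. mset_set (D j))"
    by simp
  moreover have "\<forall>j\<in>{1..m}. D j \<subseteq> C j \<and> card (D j) \<le> 1"
    using J(2) by (simp add: D_def)
  ultimately show "\<exists>D. (\<forall>j\<in>{1..m}. D j \<subseteq> C j \<and> card (D j) \<le> 1) \<and>
      R \<subseteq># (\<Sum>j=1..m. mset_set (D j))"
    by blast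
qed (use assms in auto)

section \<open>Counting lower bound on the total storage\<close>

lemma card_servers_ge:
  assumes "mcbc n N k m r C" and "k \<le> r" and "i \<in> {1..n}"
  shows "k \<le> card (servers m C i)"
proof -
  \<comment> \<open>The request for \<open>k\<close> copies of \<open>i\<close> is admissible
    because \<open>k \<le> r\<close>.\<close>
  have "set_mset (replicate_mset k i) \<subseteq> {1..n} \<and> size (replicate_mset k i) = k \<and>
      (\<forall>x. count (replicate_mset k i) x \<le> r)"
    using assms(2,3) by auto
  with assms(1) obtain D where D: "\<forall>j\<in>{1..m}. D j \<subseteq> C j \<and> card (D j) \<le> 1"
      "replicate_mset k i \<subseteq># (\<Sum>j=1..m. mset_set (D j))"
    unfolding mcbc_def by blast
  have "k \<le> count (\<Sum>j=1..m. mset_set (D j)) i"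
    using mset_subset_eq_count[OF D(2), of i] by simp
  also have "\<dots> = (\<Sum>j=1..m. count (mset_set (D j)) i)"
    by (simp add: count_sum)
  \<comment> \<open>A set yields at most one copy of \<open>i\<close>, and \<open>D j\<close> can
    yield it only if server \<open>j\<close> stores \<open>i\<close>.\<close>
  also have "\<dots> \<le> (\<Sum>j=1..m. of_bool (i \<in> C j))"
    using D(1) by (intro sum_mono) (auto simp: count_mset_set')
  also have "\<dots> = card (servers m C i)"
    by (simp add: servers_def Int_def)
  finally show ?thesis .
qed

lemma mcbc_size_ge:
  assumes "mcbc n N k m r C" and "k \<le> r"
  shows "k * n \<le> N"
proof -
  have "k * n = (\<Sum>i=1..n. k)"
    by simp
  also have "\<dots> \<le> (\<Sum>i=1..n. card (servers m C i))"
    using card_servers_ge[OF assms] by (intro sum_mono)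
  also have "\<dots> = N"
    using assms(1) sum_card_eq_sum_servers[of m C n] by (simp add: mcbc_def)
  finally show ?thesis .
qed

section \<open>Explicit regular codes: full storage and cyclic dealing\<close>

lemma regular_mcbc_full:
  assumes "k \<le> m"
  shows "regular_mcbc n (m * n) k m r (\<lambda>_. {1..n})"
proof -
  have "servers m (\<lambda>_. {1..n}) i = {1..m}" if "i \<in> {1..n}" for i
    using that by (auto simp: servers_def)
  then show ?thesis
    unfolding regular_mcbc_def using assms by (intro conjI mcbc_if_servers) auto
qed

text \<open>Counts the copies that cyclic dealing gives to server \<open>s + 1\<close>: the range
  splits into \<open>q\<close> blocks of length \<open>m\<close>, and each block meets the residue
  class once.\<close>

lemma card_residue_class:
  fixes m q s :: nat
  assumes "s < m"
  shows "card {x. x < m * q \<and> x mod m = s} = q"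
proof -
  have "{x. x < m * q \<and> x mod m = s} = (\<lambda>t. t * m + s) ` {..<q}"
  proof (intro equalityI subsetI)
    fix x assume "x \<in> {x. x < m * q \<and> x mod m = s}"
    then show "x \<in> (\<lambda>t. t * m + s) ` {..<q}"
      by (intro image_eqI[of _ _ "x div m"])
        (auto simp: less_mult_imp_div_less mult.commute)
  next
    fix x assume "x \<in> (\<lambda>t. t * m + s) ` {..<q}"
    then obtain t where t: "x = t * m + s" "t < q" by auto
    have "x < Suc t * m" using t(1) assms by simp
    also have "\<dots> \<le> q * m" using t(2) by (intro mult_right_mono) auto
    finally show "x \<in> {x. x < m * q \<and> x mod m = s}"
      using t(1) assms by (simp add: mult.commute)
  qed
  moreover have "inj_on (\<lambda>t. t * m + s) {..<q}"
    using assms by (auto simp: inj_on_def)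
  ultimately show ?thesis
    by (simp add: card_image)
qed

text \<open>Numbers with the same quotient by \<open>k\<close> differ by less than
  \<open>k \<le> m\<close>, whereas distinct numbers congruent modulo \<open>m\<close> differ by at
  least \<open>m\<close>. Hence no two copies of one item are dealt to the same server.\<close>

lemma mod_eq_imp_eq:
  fixes x y m k :: nat
  assumes "x mod m = y mod m" and "x div k = y div k" and "k \<le> m" and "k > 0"
  shows "x = y"
proof -
  have False if "a < b" "a mod m = b mod m" "a div k = b div k" for a b
  proof -
    have "m dvd b - a"
      using that mod_eq_dvd_iff_nat[of a b m] by simp
    then have "m \<le> b - a"
      using that(1) by (simp add: dvd_imp_le)
    moreover have "b - a < k"
    proof -
      have "b = a div k * k + b mod k"
        using that(3) by simp
      also have "\<dots> < a + k"
        using assms(4) by (intro add_le_less_mono) simp_all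
      finally show ?thesis
        using that(1) by simp
    qed
    ultimately show False
      using assms(3) by simp
  qed
  then show ?thesis
    using assms(1,2) by (metis nat_neq_iff)
qed

text \<open>Copy \<open>x < k n\<close> belongs to item \<open>x div k + 1\<close> and is dealt to server \<open>x mod m + 1\<close>.\<close>

definition cyclic_code :: "nat \<Rightarrow> nat \<Rightarrow> nat \<Rightarrow> nat \<Rightarrow> nat set" where
  "cyclic_code n k m j = (\<lambda>x. Suc (x div k)) ` {x. x < k * n \<and> x mod m = j - 1}"

lemma regular_mcbc_cyclic_code:
  assumes "k > 0" and "k \<le> m" and "k * n = m * q"
  shows "regular_mcbc n (m * q) k m r (cyclic_code n k m)"
proof -
  have sub: "\<forall>j\<in>{1..m}. cyclic_code n k m j \<subseteq> {1..n}"
    by (auto simp: cyclic_code_def less_mult_imp_div_less mult.commute Suc_le_eq)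
  have card: "card (cyclic_code n k m j) = q" if "j \<in> {1..m}" for j
  proof -
    \<comment> \<open>Copies dealt to one server agree modulo \<open>m\<close>, so they belong to
      distinct items, and counting copies counts stored items.\<close>
    have "inj_on (\<lambda>x. Suc (x div k)) {x. x < k * n \<and> x mod m = j - 1}"
      using mod_eq_imp_eq[OF _ _ assms(2,1)] by (auto simp: inj_on_def)
    then show ?thesis
      using that assms(3) card_residue_class[of "j - 1" m q]
      by (auto simp: cyclic_code_def card_image)
  qed
  have "k \<le> card (servers m (cyclic_code n k m) i)" if i: "i \<in> {1..n}" for i
  proof -
    \<comment> \<open>The block of the \<open>k\<close> copies of item \<open>i\<close>. They share
      their quotient by \<open>k\<close>, so their residues modulo \<open>m\<close> are distinct and
      they reach \<open>k\<close> different servers.\<close>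
    define X where "X = {(i - 1) * k..<i * k}"
    have div: "x div k = i - 1" if "x \<in> X" for x
      using that i assms(1) by (intro div_nat_eqI) (auto simp: X_def mult.commute)
    have "inj_on (\<lambda>x. Suc (x mod m)) X"
      using mod_eq_imp_eq[OF _ _ assms(2,1)] div by (auto simp: inj_on_def)
    moreover have "(\<lambda>x. Suc (x mod m)) ` X \<subseteq> servers m (cyclic_code n k m) i"
    proof (intro image_subsetI)
      fix x assume x: "x \<in> X"
      have "i * k \<le> n * k"
        using i by simp
      then have "x < k * n"
        using x unfolding X_def atLeastLessThan_iff mult.commute[of k] by linarith
      moreover have "i = Suc (x div k)"
        using div[OF x] i by simp
      ultimately have "i \<in> cyclic_code n k m (Suc (x mod m))"
        by (auto simp: cyclic_code_def)
      moreover have "x mod m < m"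
        using assms by (intro mod_less_divisor) simp
      ultimately show "Suc (x mod m) \<in> servers m (cyclic_code n k m) i"
        by (simp add: servers_def)
    qed
    ultimately have "card X \<le> card (servers m (cyclic_code n k m) i)"
      by (intro card_inj_on_le) auto
    moreover have "card X = k"
      using i by (simp add: X_def diff_mult_distrib)
    ultimately show ?thesis by simp
  qed
  then have "mcbc n (m * q) k m r (cyclic_code n k m)"
    using sub card by (intro mcbc_if_servers) auto
  then show ?thesis
    using card by (simp add: regular_mcbc_def)
qed

section \<open>The minimal storage and the divisibility criterion\<close>

lemma min_storage_ge:
  assumes "k \<le> m"
  shows "k * n \<le> m * min_storage n k m k"
proof -
  \<comment> \<open>\<open>LEAST\<close> is known to be attained once some code exists. Full storage
    supplies one whether or not \<open>m\<close> divides \<open>k * n\<close>.\<close>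
  have "\<exists>\<mu> C. regular_mcbc n (m * \<mu>) k m k C"
    using regular_mcbc_full[OF assms] by (intro exI)
  then have "\<exists>C. regular_mcbc n (m * min_storage n k m k) k m k C"
    unfolding min_storage_def by (rule LeastI_ex)
  then obtain C where "mcbc n (m * min_storage n k m k) k m k C"
    unfolding regular_mcbc_def by (elim exE conjE)
  then show ?thesis
    by (rule mcbc_size_ge) simp
qed

lemma min_storage_eq:
  assumes "k > 0" and "k \<le> m" and "k * n = m * q"
  shows "min_storage n k m k = q"
proof (rule antisym)
  show "min_storage n k m k \<le> q"
    unfolding min_storage_def using regular_mcbc_cyclic_code[OF assms] by (intro Least_le) blast
  show "q \<le> min_storage n k m k"
    \<comment> \<open>With \<open>k * n = m * q\<close> the lower bound becomes an inequality
      between multiples of \<open>m\<close>, and \<open>m\<close> cancels since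
      \<open>0 < k \<le> m\<close>.\<close>
    using min_storage_ge[OF assms(2), of n] assms by simp
qed

text \<open>Cancelling the gcd, which is positive as \<open>m > 0\<close>, leaves coprime cofactors
  of \<open>m\<close> and \<open>k\<close>; the cofactor of \<open>k\<close> can then be dropped
  from the product.\<close>

lemma dvd_mult_iff_div_gcd_dvd:
  fixes m k n :: nat
  assumes "m > 0"
  shows "m dvd k * n \<longleftrightarrow> m div gcd m k dvd n"
proof -
  define g where "g = gcd m k"
  have g: "m = g * (m div g)" "k = g * (k div g)" "g > 0"
    using assms by (auto simp: g_def)
  have "coprime (m div g) (k div g)"
    using assms by (auto simp: g_def intro: div_gcd_coprime)
  then have "m div g dvd n \<longleftrightarrow> m div g dvd k div g * n"
    by (simp add: coprime_dvd_mult_right_iff)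
  also have "\<dots> \<longleftrightarrow> g * (m div g) dvd g * (k div g * n)"
    using g(3) by simp
  also have "\<dots> \<longleftrightarrow> m dvd k * n"
    by (simp only: mult.assoc[symmetric] flip: g(1,2))
  finally show ?thesis
    by (simp add: g_def)
qed

theorem theorem4:
  fixes n k m :: nat
  assumes "n > 0" and "k > 0" and "m > 0" and "k \<le> m"
  shows "real (min_storage n k m k) = real (k * n) / real m
         \<longleftrightarrow> (\<exists>c::nat. n = c * (m div gcd m k))"
proof -
  have "real (min_storage n k m k) = real (k * n) / real m
      \<longleftrightarrow> real (m * min_storage n k m k) = real (k * n)"
    using assms(3) by (simp add: field_simps)
  also have "\<dots> \<longleftrightarrow> m * min_storage n k m k = k * n"
    by (rule of_nat_eq_iff)
  also have "\<dots> \<longleftrightarrow> m dvd k * n"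
    \<comment> \<open>Equality exhibits \<open>min_storage n k m k\<close> as the quotient of
      \<open>k * n\<close> by \<open>m\<close>. Conversely, if a quotient \<open>q\<close> exists,
      the cyclic code makes it the minimum.\<close>
    using min_storage_eq[OF assms(2,4)] by (metis dvd_def)
  also have "\<dots> \<longleftrightarrow> (\<exists>c. n = c * (m div gcd m k))"
    unfolding dvd_mult_iff_div_gcd_dvd[OF assms(3)] by (simp add: dvd_def mult.commute)
  finally show ?thesis .
qed

end
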